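(* Let $P$ satisfy (F1), (F2), (F3) and in addition (F5), let $J\ge 0$, and let $\rho\in R_0(\mathbb{R}^3)$ satisfy $E_J(\rho)=\infty$. Then for every $\sigma\in P(\rho)$ there exists $\delta>0$ such that $E_J(\rho+t\sigma)=\infty$ for all $t\in(0,\delta)$. In particular, $\rho$ is a weak local minimizer for $E_J$ on $R(\mathbb{R}^3)$.
   Context: Assumptions on the pressure: (F1) $P:[0,\infty)\to[0,\infty)$ is continuous and strictly increasing; (F2) $\lim_{s\to0^+}P(s)s^{-4/3}=0$; (F3) $\lim_{s\to\infty}P(s)s^{-4/3}=\infty$; (F5) there exists $\lambda\in(0,1)$ such that $\limsup_{s\to\infty}\dfrac{\int_{\lambda s}^{s}P(\tau)\tau^{-2}\,d\tau}{\int_0^{\lambda s}P(\tau)\tau^{-2}\,d\tau}<\infty$. Define $A(s)=s\int_0^sP(\tau)\tau^{-2}\,d\tau$ for $s>0$, $A(0)=0$. $R(\mathbb{R}^3)=\{\rho\in L^{4/3}(\mathbb{R}^3):\rho\ge0,\ \int\rho\,dx=1\}$; $R_0(\mathbb{R}^3)$ is the set of $\rho\in R(\mathbb{R}^3)$ with bounded support and center of mass $\bar x(\rho)=\int x\rho\,dx/\int\rho\,dx$ equal to $0$. $X=L^{4/3}(\mathbb{R}^3)\cap L^1(\mathbb{R}^3)$, $\widetilde U=\{\rho\in X:\rho\ge0\}$, $P(\rho)=\{\sigma\in X:\exists\,\epsilon>0\text{ such that }\rho+t\sigma\in\widetilde U\text{ for }0\le t<\epsilon\}$. $U(\rho)=\int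 A(\rho)\,dx$, $V_\rho(x)=\int\frac{\rho(y)}{|x-y|}\,dy$, $G(\rho,\rho)=\int V_\rho\rho\,dx$, $r(x)=\sqrt{x_1^2+x_2^2}$, $I(\rho)=\int\rho(x)r^2(x-\bar x(\rho))\,dx$ (convention: $I(\rho)=\infty$ and $J^2/(2I(\rho))=0$ if $\int r^2\rho\,dx=\infty$), and, for $\rho\in\widetilde U$ with positive mass, $E_J(\rho)=U(\rho)-\frac12G(\rho,\rho)+\frac{J^2}{2I(\rho)}\in(-\infty,\infty]$. Weak local minimizer of $E_J$ on $R(\mathbb{R}^3)$: $\rho\in R(\mathbb{R}^3)$ such that for each $\sigma\in P(\rho)$ with $\rho+t\sigma\in R(\mathbb{R}^3)$ for all sufficiently small $t>0$, there is a sequence $t_n>0$, $t_n\to0$, with $E_J(\rho+t_n\sigma)\ge E_J(\rho)$ for all $n$ large enough. *)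

theory Defs
  imports "HOL-Analysis.Analysis"
begin

section \<open>Pressure laws and internal energy density\<close>

definition F1 :: "(real \<Rightarrow> real) \<Rightarrow> bool" where
  "F1 P \<longleftrightarrow> P ` {0..} \<subseteq> {0..} \<and> continuous_on {0..} P \<and> strict_mono_on {0..} P"

definition F2 :: "(real \<Rightarrow> real) \<Rightarrow> bool" where
  "F2 P \<longleftrightarrow> ((\<lambda>s. P s * s powr (- 4 / 3)) \<longlongrightarrow> 0) (at_right 0)"

definition F3 :: "(real \<Rightarrow> real) \<Rightarrow> bool" where
  "F3 P \<longleftrightarrow> filterlim (\<lambda>s. P s * s powr (- 4 / 3)) at_top at_top"

text \<open>Under (F1) and (F2) the integrand is integrable near \<open>0\<close>, because there
  \<open>P \<tau> / \<tau>\<^sup>2\<close> is bounded by a multiple of \<open>\<tau> powr (- 2 / 3)\<close>.\<close>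

definition P_int :: "(real \<Rightarrow> real) \<Rightarrow> real \<Rightarrow> real \<Rightarrow> real" where
  "P_int P a b = (LINT \<tau>:{a..b}|lborel. P \<tau> / \<tau>\<^sup>2)"

definition F5 :: "(real \<Rightarrow> real) \<Rightarrow> bool" where
  "F5 P \<longleftrightarrow> (\<exists>l. 0 < l \<and> l < 1 \<and>
     Limsup at_top (\<lambda>s. ereal (P_int P (l * s) s / P_int P 0 (l * s))) < \<infinity>)"

definition A_density :: "(real \<Rightarrow> real) \<Rightarrow> real \<Rightarrow> real" where
  "A_density P s = s * P_int P 0 s"


section \<open>Spaces of densities\<close>

text \<open>Elements of Lebesgue spaces are represented by measurable functions, so pointwise
  conditions (sign, support) are required almost everywhere.\<close>

definition Lp :: "real \<Rightarrow> (real^3 \<Rightarrow> real) set" where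
  "Lp p = {f \<in> borel_measurable lebesgue. integrable lebesgue (\<lambda>x. \<bar>f x\<bar> powr p)}"

definition X_space :: "(real^3 \<Rightarrow> real) set" where
  "X_space = Lp (4 / 3) \<inter> Lp 1"

definition U_tilde :: "(real^3 \<Rightarrow> real) set" where
  "U_tilde = {\<rho> \<in> X_space. AE x in lebesgue. 0 \<le> \<rho> x}"

definition mass :: "(real^3 \<Rightarrow> real) \<Rightarrow> real" where
  "mass \<rho> = (LINT x|lebesgue. \<rho> x)"

definition R_class :: "(real^3 \<Rightarrow> real) set" where
  "R_class = {\<rho> \<in> Lp (4 / 3). (AE x in lebesgue. 0 \<le> \<rho> x) \<and>
        integrable lebesgue \<rho> \<and> mass \<rho> = 1}"

text \<open>The centre of mass is taken componentwise: the vector-valued Bochner integral would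
  vanish altogether as soon as a single component fails to converge, whereas only the
  first two components enter the moment of inertia.\<close>

definition center_of_mass :: "(real^3 \<Rightarrow> real) \<Rightarrow> real^3" where
  "center_of_mass \<rho> = (\<chi> i. (LINT x|lebesgue. x $ i * \<rho> x) / mass \<rho>)"

definition R0_class :: "(real^3 \<Rightarrow> real) set" where
  "R0_class = {\<rho> \<in> R_class. (\<exists>B. bounded B \<and> (AE x in lebesgue. x \<notin> B \<longrightarrow> \<rho> x = 0)) \<and>
         center_of_mass \<rho> = 0}"

definition admissible :: "(real^3 \<Rightarrow> real) \<Rightarrow> (real^3 \<Rightarrow> real) set" where
  "admissible \<rho> = {\<sigma> \<in> X_space. \<exists>\<epsilon>>0. \<forall>t. 0 \<le> t \<and> t < \<epsilon> \<longrightarrow> (\<lambda>x. \<rho> x + t * \<sigma> x) \<in> U_tilde}"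


section \<open>Energy\<close>

definition U_energy :: "(real \<Rightarrow> real) \<Rightarrow> (real^3 \<Rightarrow> real) \<Rightarrow> ennreal" where
  "U_energy P \<rho> = (\<integral>\<^sup>+x. ennreal (A_density P (\<rho> x)) \<partial>lebesgue)"

text \<open>For \<open>\<rho>\<close> in \<^const>\<open>U_tilde\<close>, the integral \<open>V_potential \<rho> x\<close> converges for almost every \<open>x\<close> and
  \<open>G_energy \<rho>\<close> converges, by the Hardy-Littlewood-Sobolev inequality
  (\<^const>\<open>X_space\<close> embeds into Lebesgue space of exponent \<open>6 / 5\<close>), so real-valued integrals suffice.\<close>

definition V_potential :: "(real^3 \<Rightarrow> real) \<Rightarrow> real^3 \<Rightarrow> real" where
  "V_potential \<rho> x = (LINT y|lebesgue. \<rho> y / norm (x - y))"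

definition G_energy :: "(real^3 \<Rightarrow> real) \<Rightarrow> real" where
  "G_energy \<rho> = (LINT x|lebesgue. V_potential \<rho> x * \<rho> x)"

definition axis_dist :: "real^3 \<Rightarrow> real" where
  "axis_dist x = sqrt ((x $ 1)\<^sup>2 + (x $ 2)\<^sup>2)"

definition inertia :: "(real^3 \<Rightarrow> real) \<Rightarrow> ennreal" where
  "inertia \<rho> = (if (\<integral>\<^sup>+x. ennreal ((axis_dist x)\<^sup>2 * \<rho> x) \<partial>lebesgue) = \<infinity> then \<infinity>
          else (\<integral>\<^sup>+x. ennreal (\<rho> x * (axis_dist (x - center_of_mass \<rho>))\<^sup>2) \<partial>lebesgue))"

text \<open>The energy is meaningful on \<open>energy_domain\<close> only. Division in \<^typ>\<open>ennreal\<close> makes the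
  rotational term \<open>0\<close> when \<open>inertia \<rho> = \<infinity>\<close>.\<close>

definition energy_domain :: "(real^3 \<Rightarrow> real) set" where
  "energy_domain = {\<rho> \<in> U_tilde. 0 < mass \<rho>}"

definition E_energy :: "(real \<Rightarrow> real) \<Rightarrow> real \<Rightarrow> (real^3 \<Rightarrow> real) \<Rightarrow> ereal" where
  "E_energy P J \<rho> = enn2ereal (U_energy P \<rho>) - ereal (G_energy \<rho> / 2) + enn2ereal (ennreal (J\<^sup>2) / (2 * inertia \<rho>))"

definition weak_local_minimizer :: "(real \<Rightarrow> real) \<Rightarrow> real \<Rightarrow> (real^3 \<Rightarrow> real) \<Rightarrow> bool" where
  "weak_local_minimizer P J \<rho> \<longleftrightarrow> \<rho> \<in> R_class \<and>
     (\<forall>\<sigma> \<in> admissible \<rho>. (\<forall>\<^sub>F t in at_right 0. (\<lambda>x. \<rho> x + t * \<sigma> x) \<in> R_class) \<longrightarrow>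
        (\<exists>t :: nat \<Rightarrow> real. (\<forall>n. 0 < t n) \<and> t \<longlonglongrightarrow> 0 \<and>
           (\<forall>\<^sub>F n in sequentially. E_energy P J (\<lambda>x. \<rho> x + t n * \<sigma> x) \<ge> E_energy P J \<rho>)))"

end

theory Submission
  imports Defs
begin

text \<open>
  For small \<open>t\<close>, \<open>\<rho> + t \<sigma>\<close> is a convex combination of \<open>\<rho>\<close> and a fixed nonnegative density
  \<open>\<rho> + \<eta> \<sigma>\<close>, so it dominates \<open>l \<rho>\<close> with \<open>l < 1\<close> taken from (F5). That hypothesis says
  \<open>A s \<le> C A (l s)\<close> for large \<open>s\<close>, while \<open>A\<close> is at most linear on bounded intervals; hence
  \<open>U \<rho> = \<infinity>\<close> forces \<open>U (l \<rho>) = \<infinity>\<close>. Finally \<open>E \<rho> = \<infinity>\<close> does entail \<open>U \<rho> = \<infinity>\<close>, because a density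
  of positive mass cannot be concentrated on the axis of rotation.
\<close>

section \<open>The integrand \<open>P \<tau> / \<tau>\<^sup>2\<close> and its integrals\<close>

lemma P_pos:
  assumes "F1 P" "0 < s"
  shows "0 < P s"
proof -
  have "0 \<le> P 0" using assms by (auto simp: F1_def)
  moreover have "P 0 < P s"
    using assms by (auto simp: F1_def intro: strict_mono_onD)
  ultimately show ?thesis by simp
qed

lemma P_div_square_nonneg:
  assumes "F1 P" "0 \<le> x"
  shows "0 \<le> P x / x\<^sup>2"
  using assms by (auto simp: F1_def)

lemma P_div_square_continuous:
  assumes "F1 P" "S \<subseteq> {0<..}"
  shows "continuous_on S (\<lambda>\<tau>. P \<tau> / \<tau>\<^sup>2)"
proof (intro continuous_intros)
  show "continuous_on S P"
    using assms by (auto simp: F1_def intro!: continuous_on_subset[of "{0..}" P])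
qed (use assms in auto)

lemma P_div_square_measurable:
  assumes "F1 P"
  shows "set_borel_measurable lborel {0..b} (\<lambda>\<tau>. P \<tau> / \<tau>\<^sup>2)"
proof -
  have "(\<lambda>\<tau>. indicator {0<..b} \<tau> *\<^sub>R (P \<tau> / \<tau>\<^sup>2)) \<in> borel_measurable borel"
    by (rule borel_measurable_continuous_on_indicator)
       (auto intro!: P_div_square_continuous assms)
  \<comment> \<open>At \<open>\<tau> = 0\<close> the quotient is a division by zero, hence 0, so
    including the endpoint changes nothing.\<close>
  also have "(\<lambda>\<tau>. indicator {0<..b} \<tau> *\<^sub>R (P \<tau> / \<tau>\<^sup>2)) = (\<lambda>\<tau>. indicator {0..b} \<tau> *\<^sub>R (P \<tau> / \<tau>\<^sup>2))"
    by (auto simp: indicator_def fun_eq_iff)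
  finally show ?thesis
    by (simp add: set_borel_measurable_def)
qed

lemma powr_set_integrable:
  fixes a c :: real
  assumes "-1 < a" "0 \<le> c"
  shows "set_integrable lborel {0..c} (\<lambda>x. x powr a)"
proof -
  have "(\<lambda>x. x powr a) absolutely_integrable_on {0..c}"
    using has_integral_powr_from_0[OF assms]
    by (intro nonnegative_absolutely_integrable_1) (auto simp: integrable_on_def)
  then show ?thesis
    \<comment> \<open>Absolute integrability refers to \<open>lebesgue\<close>, the completion of
      \<open>lborel\<close>; Borel measurability of the power lets it descend to
      \<open>lborel\<close>.\<close>
    unfolding set_integrable_def by (subst (asm) integrable_completion) auto
qed

text \<open>By (F2), \<open>P s\<close> stays below \<open>s powr (4/3)\<close> near 0, so the
  integrand is at most \<open>s powr (-2/3)\<close> there, whose exponent exceeds -1. Away from 0 it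
  is continuous on a compact interval.\<close>

lemma P_div_square_integrable:
  assumes "F1 P" "F2 P"
  shows "set_integrable lborel {0..b} (\<lambda>\<tau>. P \<tau> / \<tau>\<^sup>2)"
proof -
  have "\<forall>\<^sub>F s in at_right 0. P s * s powr (-4/3) < 1"
    using assms(2) unfolding F2_def by (rule order_tendstoD) simp
  then obtain e where e: "0 < e" "\<And>s. 0 < s \<Longrightarrow> s < e \<Longrightarrow> P s * s powr (-4/3) < 1"
    by (auto simp: eventually_at_right_field)
  have near: "set_integrable lborel {0..e/2} (\<lambda>\<tau>. P \<tau> / \<tau>\<^sup>2)"
  proof (rule set_integrable_bound)
    show "set_integrable lborel {0..e/2} (\<lambda>x. x powr (-2/3))"
      using e(1) by (intro powr_set_integrable) auto
    show "set_borel_measurable lborel {0..e/2} (\<lambda>\<tau>. P \<tau> / \<tau>\<^sup>2)"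
      by (rule P_div_square_measurable[OF assms(1)])
    have "P x / x\<^sup>2 \<le> x powr (-2/3)" if "0 < x" "x \<le> e/2" for x
    proof -
      have "P x / x\<^sup>2 = P x * x powr (-4/3) * x powr (-2/3)"
        using that by (simp add: powr_add[symmetric] mult.assoc powr_minus powr_numeral field_simps)
      also have "\<dots> \<le> 1 * x powr (-2/3)"
        using e(2)[of x] that e(1) by (intro mult_right_mono) auto
      finally show ?thesis by simp
    qed
    moreover have "norm (P x / x\<^sup>2) = P x / x\<^sup>2" if "0 \<le> x" for x
      using P_div_square_nonneg[OF assms(1) that] by (simp only: real_norm_def abs_of_nonneg)
    ultimately have "norm (P x / x\<^sup>2) \<le> norm (x powr (-2/3))" if "x \<in> {0..e/2}" for x
      using that by (cases "x = 0") (simp, simp del: real_norm_def, simp)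
    then show "AE x in lborel. x \<in> {0..e/2} \<longrightarrow> norm (P x / x\<^sup>2) \<le> norm (x powr (-2/3))"
      by auto
  qed
  have far: "set_integrable lborel {e/2..b} (\<lambda>\<tau>. P \<tau> / \<tau>\<^sup>2)"
    unfolding set_integrable_def using e(1)
    by (intro borel_integrable_compact P_div_square_continuous assms) auto
  show ?thesis
    by (rule set_integrable_subset[OF set_integrable_Un[OF near far]]) auto
qed

lemma P_int_nonneg:
  assumes "F1 P"
  shows "0 \<le> P_int P 0 b"
  unfolding P_int_def set_lebesgue_integral_def
  by (intro Bochner_Integration.integral_nonneg)
     (use P_div_square_nonneg[OF assms] in \<open>auto simp: indicator_def\<close>)

lemma P_int_split:
  assumes "F1 P" "F2 P" "0 \<le> a" "a \<le> b"
  shows "P_int P 0 b = P_int P 0 a + P_int P a b"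
proof -
  have int: "set_integrable lborel {0..b} (\<lambda>\<tau>. P \<tau> / \<tau>\<^sup>2)"
    by (rule P_div_square_integrable[OF assms(1,2)])
  have "(LINT \<tau>:{0..a} \<union> {a..b}|lborel. P \<tau> / \<tau>\<^sup>2) = P_int P 0 a + P_int P a b"
    unfolding P_int_def
  proof (rule set_integral_Un_AE)
    show "AE x in lborel. \<not> (x \<in> {0..a} \<and> x \<in> {a..b})"
      using AE_lborel_singleton[of a] by eventually_elim auto
    show "set_integrable lborel {0..a} (\<lambda>\<tau>. P \<tau> / \<tau>\<^sup>2)"
         "set_integrable lborel {a..b} (\<lambda>\<tau>. P \<tau> / \<tau>\<^sup>2)"
      using assms by (auto intro: set_integrable_subset[OF int])
  qed auto
  moreover have "{0..a} \<union> {a..b} = {0..b}" using assms by auto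
  ultimately show ?thesis by (simp add: P_int_def)
qed

text \<open>On \<open>{s/2..s}\<close> monotonicity of \<open>P\<close> bounds the integrand below
  by the positive constant \<open>P (s/2) / s\<^sup>2\<close>. This makes the denominator in (F5)
  positive, so that the quotient bound can be multiplied out.\<close>

lemma P_int_pos:
  assumes "F1 P" "F2 P" "0 < s"
  shows "0 < P_int P 0 s"
proof -
  have "0 < (P (s/2) / s\<^sup>2) * (s - s/2)"
    using P_pos[OF assms(1), of "s/2"] assms(3) by auto
  also have "\<dots> = (LINT \<tau>:{s/2..s}|lborel. P (s/2) / s\<^sup>2)"
    using assms(3) by (subst set_integral_const) (auto simp: mult.commute)
  also have "\<dots> \<le> P_int P (s/2) s"
    unfolding P_int_def
  proof (rule set_integral_mono)
    show "set_integrable lborel {s/2..s} (\<lambda>\<tau>. P \<tau> / \<tau>\<^sup>2)"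
      by (rule set_integrable_subset[OF P_div_square_integrable[OF assms(1,2), of s]])
         (use assms(3) in auto)
    show "set_integrable lborel {s/2..s} (\<lambda>\<tau>. P (s/2) / s\<^sup>2)"
      unfolding set_integrable_def by (intro borel_integrable_compact) auto
    fix x assume x: "x \<in> {s/2..s}"
    have "P (s/2) \<le> P x"
      using assms x by (auto simp: F1_def intro: strict_mono_on_leD)
    then show "P (s/2) / s\<^sup>2 \<le> P x / x\<^sup>2"
      using x assms(3) P_pos[OF assms(1), of "s/2"]
      by (intro frac_le power_mono) auto
  qed
  also have "\<dots> \<le> P_int P 0 s"
    using P_int_split[OF assms(1,2), of "s/2" s] P_int_nonneg[OF assms(1)] assms(3) by auto
  finally show ?thesis .
qed

lemma P_int_mono:
  assumes "F1 P" "F2 P" "a \<le> b"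
  shows "P_int P 0 a \<le> P_int P 0 b"
proof -
  have int: "set_integrable lborel {0..c} (\<lambda>\<tau>. P \<tau> / \<tau>\<^sup>2)" for c
    by (rule P_div_square_integrable[OF assms(1,2)])
  show ?thesis
    unfolding P_int_def set_lebesgue_integral_def
    by (rule integral_mono[OF int[unfolded set_integrable_def] int[unfolded set_integrable_def]])
       (use assms(3) P_div_square_nonneg[OF assms(1)] in \<open>auto simp: indicator_def\<close>)
qed

section \<open>The internal energy density\<close>

lemma A_density_nonpos [simp]: "s \<le> 0 \<Longrightarrow> A_density P s = 0"
  by (cases "s = 0") (auto simp: A_density_def P_int_def set_lebesgue_integral_def)

lemma A_density_nonneg:
  assumes "F1 P"
  shows "0 \<le> A_density P s"
  using P_int_nonneg[OF assms, of s] by (cases "s \<le> 0") (simp, simp add: A_density_def)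

text \<open>Vanishing on the negative half-line makes monotonicity global. This yields both Borel
  measurability of \<open>A_density P\<close> and monotonicity of \<open>U_energy P\<close>.\<close>

lemma A_density_mono:
  assumes "F1 P" "F2 P"
  shows "mono (A_density P)"
proof (rule monoI)
  fix s u :: real assume "s \<le> u"
  show "A_density P s \<le> A_density P u"
  proof (cases "0 \<le> s")
    case True
    then show ?thesis
      using \<open>s \<le> u\<close> P_int_nonneg[OF assms(1)] P_int_mono[OF assms]
      unfolding A_density_def by (intro mult_mono) auto
  next
    case False
    then have "A_density P s = 0" by simp
    then show ?thesis using A_density_nonneg[OF assms(1)] by simp
  qed
qed

text \<open>For large \<open>s\<close>, (F5) controls the integral over \<open>{l * s..s}\<close> by
  the one over \<open>{0..l * s}\<close>, which gives the term with \<open>C\<close>. For the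
  remaining \<open>s\<close> the integral is at most its value at a fixed threshold, which gives the
  linear term; for an integrable density that term contributes only a finite amount.\<close>

lemma A_density_scaling_bound:
  assumes "F1 P" "F2 P" "F5 P"
  obtains l C K where "0 < l" "l < 1" "0 \<le> C" "0 \<le> K"
    "\<And>s. 0 \<le> s \<Longrightarrow> A_density P s \<le> C * A_density P (l * s) + K * s"
proof -
  obtain l where l: "0 < l" "l < 1"
    "Limsup at_top (\<lambda>s. ereal (P_int P (l * s) s / P_int P 0 (l * s))) < \<infinity>"
    using assms(3) unfolding F5_def by blast
  \<comment> \<open>Taking the bound to be a natural number makes it nonnegative at once.\<close>
  obtain c :: nat where
    "Limsup at_top (\<lambda>s. ereal (P_int P (l * s) s / P_int P 0 (l * s))) < ereal (real c)"
    using less_PInf_Ex_of_nat l(3) by auto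
  then have "\<forall>\<^sub>F s in at_top. ereal (P_int P (l * s) s / P_int P 0 (l * s)) < ereal (real c)"
    by (rule Limsup_lessD)
  then obtain N where N: "\<And>s. N \<le> s \<Longrightarrow> P_int P (l * s) s / P_int P 0 (l * s) < real c"
    by (auto simp: eventually_at_top_linorder)
  \<comment> \<open>The factor \<open>1 / l\<close> arises because
    \<open>A_density P (l * s)\<close> carries the prefactor \<open>l * s\<close> instead of
    \<open>s\<close>.\<close>
  define C where "C = (1 + real c) / l"
  define K where "K = P_int P 0 N"
  have "0 \<le> C" "0 \<le> K"
    using l P_int_nonneg[OF assms(1)] by (auto simp: C_def K_def)
  moreover have "A_density P s \<le> C * A_density P (l * s) + K * s" if "0 \<le> s" for s
  proof (cases "s = 0 \<or> s < N")
    case True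
    have "A_density P s \<le> K * s"
    proof (cases "s = 0")
      case False
      then have "P_int P 0 s \<le> K"
        using True P_int_mono[OF assms(1,2), of s N] by (simp add: K_def)
      then have "s * P_int P 0 s \<le> s * K"
        using that by (rule mult_left_mono)
      then show ?thesis by (simp add: A_density_def mult.commute)
    qed simp
    moreover have "0 \<le> C * A_density P (l * s)"
      using \<open>0 \<le> C\<close> A_density_nonneg[OF assms(1)] by simp
    ultimately show ?thesis by linarith
  next
    case False
    then have s: "0 < s" "N \<le> s" using that by auto
    have "0 < P_int P 0 (l * s)"
      using l s by (intro P_int_pos assms) auto
    then have "P_int P (l * s) s \<le> real c * P_int P 0 (l * s)"
      using N[OF s(2)] by (simp add: field_simps)
    moreover have "l * s \<le> s"
      using l s by simp
    ultimately have "P_int P 0 s \<le> (1 + real c) * P_int P 0 (l * s)"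
      using P_int_split[OF assms(1,2), of "l * s" s] l s by (simp add: algebra_simps)
    then have "s * P_int P 0 s \<le> s * ((1 + real c) * P_int P 0 (l * s))"
      using s by (intro mult_left_mono) auto
    also have "\<dots> = C * A_density P (l * s)"
      using l by (simp add: C_def A_density_def)
    finally have "A_density P s \<le> C * A_density P (l * s)"
      by (simp add: A_density_def)
    moreover have "0 \<le> K * s" using \<open>0 \<le> K\<close> that by simp
    ultimately show ?thesis by linarith
  qed
  ultimately show ?thesis using that l by blast
qed

section \<open>Infinite internal energy under scaling\<close>

text \<open>Integrating the pointwise bound gives \<open>U_energy P \<rho>\<close> at most
  \<open>C\<close> times the scaled energy plus \<open>K * mass \<rho>\<close>, so a finite scaled
  energy would be contradictory. The factor \<open>l\<close> depends on \<open>P\<close>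
  alone.\<close>

lemma U_energy_scaled_eq_top:
  assumes "F1 P" "F2 P" "F5 P"
  obtains l where "0 < l" "l < 1"
    "\<And>\<rho>. integrable lebesgue \<rho> \<Longrightarrow> AE x in lebesgue. 0 \<le> \<rho> x \<Longrightarrow> U_energy P \<rho> = \<infinity> \<Longrightarrow>
       U_energy P (\<lambda>x. l * \<rho> x) = \<infinity>"
proof -
  obtain l C K where l: "0 < l" "l < 1" and "0 \<le> C" "0 \<le> K"
    and bound: "\<And>s. 0 \<le> s \<Longrightarrow> A_density P s \<le> C * A_density P (l * s) + K * s"
    using A_density_scaling_bound[OF assms] by blast
  have [measurable]: "A_density P \<in> borel_measurable borel"
    by (rule borel_measurable_mono[OF A_density_mono[OF assms(1,2)]])
  have "U_energy P (\<lambda>x. l * \<rho> x) = \<infinity>"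
    if int: "integrable lebesgue \<rho>" and nonneg: "AE x in lebesgue. 0 \<le> \<rho> x"
      and top: "U_energy P \<rho> = \<infinity>" for \<rho>
  proof (rule ccontr)
    assume fin: "U_energy P (\<lambda>x. l * \<rho> x) \<noteq> \<infinity>"
    have [measurable]: "\<rho> \<in> borel_measurable lebesgue" using int by auto
    have "U_energy P \<rho> \<le>
        (\<integral>\<^sup>+x. ennreal C * ennreal (A_density P (l * \<rho> x)) + ennreal (K * \<rho> x) \<partial>lebesgue)"
      unfolding U_energy_def
    proof (rule nn_integral_mono_AE)
      show "AE x in lebesgue. ennreal (A_density P (\<rho> x))
          \<le> ennreal C * ennreal (A_density P (l * \<rho> x)) + ennreal (K * \<rho> x)"
        using nonneg
      proof eventually_elim
        case (elim x)
        have "ennreal (A_density P (\<rho> x)) \<le> ennreal (C * A_density P (l * \<rho> x) + K * \<rho> x)"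
          using bound[OF elim] by (rule ennreal_leI)
        also have "\<dots> = ennreal C * ennreal (A_density P (l * \<rho> x)) + ennreal (K * \<rho> x)"
          using elim \<open>0 \<le> C\<close> \<open>0 \<le> K\<close> A_density_nonneg[OF assms(1)]
          by (simp add: ennreal_plus ennreal_mult)
        finally show ?case .
      qed
    qed
    also have "\<dots> = ennreal C * U_energy P (\<lambda>x. l * \<rho> x) + (\<integral>\<^sup>+x. ennreal (K * \<rho> x) \<partial>lebesgue)"
      unfolding U_energy_def by (subst nn_integral_add) (auto simp: nn_integral_cmult)
    also have "(\<integral>\<^sup>+x. ennreal (K * \<rho> x) \<partial>lebesgue) = ennreal (LINT x|lebesgue. K * \<rho> x)"
      using int nonneg \<open>0 \<le> K\<close> by (intro nn_integral_eq_integral) auto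
    also have "ennreal C * U_energy P (\<lambda>x. l * \<rho> x) + \<dots> < \<infinity>"
      using fin by (auto simp: ennreal_mult_less_top less_top)
    finally show False using top by simp
  qed
  then show ?thesis using that l by blast
qed

section \<open>Finiteness of the rotational term\<close>

text \<open>Zero inertia would force \<open>\<rho>\<close> to vanish almost everywhere off a line
  parallel to the rotation axis. That line lies in a plane, which is a null set, so the mass would
  be 0.\<close>

lemma inertia_pos:
  assumes int: "integrable lebesgue \<rho>" and nonneg: "AE x in lebesgue. 0 \<le> \<rho> x"
    and "0 < mass \<rho>"
  shows "0 < inertia \<rho>"
proof (rule ccontr)
  assume "\<not> 0 < inertia \<rho>"
  define c where "c = center_of_mass \<rho>"
  have [measurable]: "\<rho> \<in> borel_measurable lebesgue" using int by auto
  have "(\<lambda>x. (axis_dist (x - c))\<^sup>2) \<in> borel_measurable lborel"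
    unfolding axis_dist_def measurable_lborel2
    by (intro borel_measurable_continuous_onI continuous_intros continuous_on_component)
  then have [measurable]: "(\<lambda>x. (axis_dist (x - c))\<^sup>2) \<in> borel_measurable lebesgue"
    by (rule measurable_completion)
  \<comment> \<open>The first branch of \<open>inertia\<close> has value \<infinity>, so zero
    inertia selects the second.\<close>
  have "(\<integral>\<^sup>+x. ennreal (\<rho> x * (axis_dist (x - c))\<^sup>2) \<partial>lebesgue) = 0"
    using \<open>\<not> 0 < inertia \<rho>\<close> by (auto simp: inertia_def c_def split: if_splits)
  then have "AE x in lebesgue. ennreal (\<rho> x * (axis_dist (x - c))\<^sup>2) = 0"
    by (subst (asm) nn_integral_0_iff_AE) auto
  moreover have "AE x in lebesgue. x \<notin> {x::real^3. x $ 1 = c $ 1}"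
    using negligible_standard_hyperplane[of "axis 1 1 :: real^3" "c $ 1"]
    by (intro AE_not_in) (simp add: inner_axis negligible_iff_null_sets)
  ultimately have "AE x in lebesgue. \<rho> x = 0"
    using nonneg
  proof eventually_elim
    case (elim x)
    have "0 < (x $ 1 - c $ 1)\<^sup>2" using elim by simp
    also have "\<dots> \<le> (axis_dist (x - c))\<^sup>2" by (simp add: axis_dist_def)
    finally show ?case
      using elim by (auto simp: ennreal_eq_0_iff mult_le_0_iff)
  qed
  then have "mass \<rho> = 0"
    unfolding mass_def by (rule integral_eq_zero_AE)
  then show False using assms(3) by simp
qed

text \<open>Positive inertia keeps the rotational term finite and \<open>G_energy\<close> is
  real-valued, so only the internal energy can be infinite.\<close>

lemma E_energy_eq_top_iff:
  assumes "integrable lebesgue \<rho>" "AE x in lebesgue. 0 \<le> \<rho> x" "0 < mass \<rho>"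
  shows "E_energy P J \<rho> = \<infinity> \<longleftrightarrow> U_energy P \<rho> = \<infinity>"
proof -
  have "ennreal (J\<^sup>2) / (2 * inertia \<rho>) \<noteq> top"
    using inertia_pos[OF assms] by (auto simp: ennreal_divide_eq_top_iff)
  then obtain r where "0 \<le> r" "ennreal (J\<^sup>2) / (2 * inertia \<rho>) = ennreal r"
    by (cases "ennreal (J\<^sup>2) / (2 * inertia \<rho>)") auto
  then show ?thesis
    by (cases "U_energy P \<rho>") (auto simp: E_energy_def)
qed

lemma X_space_integrable:
  assumes "f \<in> X_space"
  shows "integrable lebesgue f"
  using assms by (auto simp: X_space_def Lp_def integrable_abs_iff)

section \<open>Perturbation in admissible directions\<close>

lemma U_energy_mono:
  assumes "F1 P" "F2 P" "AE x in lebesgue. f x \<le> g x"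
  shows "U_energy P f \<le> U_energy P g"
  unfolding U_energy_def
  using assms(3) by (intro nn_integral_mono_AE)
    (auto elim!: eventually_mono intro!: ennreal_leI monoD[OF A_density_mono[OF assms(1,2)]])

lemma E_energy_top_along_admissible:
  assumes "F1 P" "F2 P" "F5 P"
    and \<rho>: "integrable lebesgue \<rho>" "AE x in lebesgue. 0 \<le> \<rho> x" "0 < mass \<rho>"
    and top: "E_energy P J \<rho> = \<infinity>" and \<sigma>: "\<sigma> \<in> admissible \<rho>"
  shows "\<exists>\<delta>>0. \<forall>t. 0 < t \<and> t < \<delta> \<longrightarrow>
    (\<lambda>x. \<rho> x + t * \<sigma> x) \<in> energy_domain \<and> E_energy P J (\<lambda>x. \<rho> x + t * \<sigma> x) = \<infinity>"
proof -
  obtain l where l: "0 < l" "l < 1" "U_energy P (\<lambda>x. l * \<rho> x) = \<infinity>"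
    using U_energy_scaled_eq_top[OF assms(1-3)] E_energy_eq_top_iff[OF \<rho>] top \<rho> by metis
  obtain \<epsilon> where \<epsilon>: "0 < \<epsilon>"
    "\<And>t. 0 \<le> t \<Longrightarrow> t < \<epsilon> \<Longrightarrow> (\<lambda>x. \<rho> x + t * \<sigma> x) \<in> U_tilde"
    using \<sigma> by (auto simp: admissible_def)
  have \<sigma>_int: "integrable lebesgue \<sigma>"
    using \<sigma> by (auto simp: admissible_def intro: X_space_integrable)
  \<comment> \<open>Admissibility covers only parameters strictly below \<epsilon>, so the fixed
    endpoint of the segment is taken inside.\<close>
  define \<eta> where "\<eta> = \<epsilon> / 2"
  have \<eta>: "0 < \<eta>" "\<eta> < \<epsilon>" using \<epsilon>(1) by (auto simp: \<eta>_def)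
  have "((\<lambda>t. mass \<rho> + t * mass \<sigma>) \<longlongrightarrow> mass \<rho> + 0 * mass \<sigma>) (at_right 0)"
    by (intro tendsto_intros)
  then have "\<forall>\<^sub>F t in at_right 0. 0 < mass \<rho> + t * mass \<sigma>"
    by (rule order_tendstoD) (use \<rho>(3) in simp)
  then obtain d where d: "0 < d" "\<And>t. 0 < t \<Longrightarrow> t < d \<Longrightarrow> 0 < mass \<rho> + t * mass \<sigma>"
    by (auto simp: eventually_at_right_field)
  \<comment> \<open>The bound \<open>d\<close> keeps the mass positive;
    \<open>(1 - l) * \<eta>\<close> keeps the weight \<open>1 - t / \<eta>\<close> of \<rho> at
    least \<open>l\<close>.\<close>
  define \<delta> where "\<delta> = min d ((1 - l) * \<eta>)"
  have "0 < \<delta>" using d(1) l \<eta> by (simp add: \<delta>_def)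
  moreover have "(\<lambda>x. \<rho> x + t * \<sigma> x) \<in> energy_domain \<and> E_energy P J (\<lambda>x. \<rho> x + t * \<sigma> x) = \<infinity>"
    if t: "0 < t" "t < \<delta>" for t
  proof -
    have t': "t < d" "t < (1 - l) * \<eta>" using t by (auto simp: \<delta>_def)
    have "(1 - l) * \<eta> \<le> 1 * \<eta>" using l \<eta> by (intro mult_right_mono) auto
    then have "t < \<epsilon>" using t' \<eta> by linarith
    then have in_U: "(\<lambda>x. \<rho> x + t * \<sigma> x) \<in> U_tilde"
      using \<epsilon>(2) t by simp
    have "mass (\<lambda>x. \<rho> x + t * \<sigma> x) = mass \<rho> + t * mass \<sigma>"
      unfolding mass_def using \<rho>(1) \<sigma>_int by simp
    then have mass_pos: "0 < mass (\<lambda>x. \<rho> x + t * \<sigma> x)"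
      using d(2) t t' by simp
    have "AE x in lebesgue. 0 \<le> \<rho> x + \<eta> * \<sigma> x"
      using \<epsilon>(2)[of \<eta>] \<eta> by (simp add: U_tilde_def)
    then have "AE x in lebesgue. l * \<rho> x \<le> \<rho> x + t * \<sigma> x"
      using \<rho>(2)
    proof eventually_elim
      case (elim x)
      have "l \<le> 1 - t / \<eta>" using t' \<eta> by (simp add: field_simps)
      then have "l * \<rho> x \<le> (1 - t / \<eta>) * \<rho> x" using elim by (intro mult_right_mono)
      \<comment> \<open>The added term is the nonnegative density at parameter \<eta> with weight
        \<open>t / \<eta>\<close>; the sum is the convex combination equal to
        \<open>\<rho> x + t * \<sigma> x\<close>.\<close>
      also have "\<dots> \<le> (1 - t / \<eta>) * \<rho> x + t / \<eta> * (\<rho> x + \<eta> * \<sigma> x)"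
        using elim t \<eta> by simp
      also have "\<dots> = \<rho> x + t * \<sigma> x" using \<eta> by (simp add: field_simps)
      finally show ?case .
    qed
    then have "U_energy P (\<lambda>x. \<rho> x + t * \<sigma> x) = \<infinity>"
      using U_energy_mono[OF assms(1,2)] l(3) by (metis infinity_ennreal_def top.extremum_uniqueI)
    moreover have "integrable lebesgue (\<lambda>x. \<rho> x + t * \<sigma> x)"
      using \<rho>(1) \<sigma>_int by simp
    ultimately show ?thesis
      using in_U mass_pos E_energy_eq_top_iff[of "\<lambda>x. \<rho> x + t * \<sigma> x" P J]
      by (simp add: energy_domain_def U_tilde_def)
  qed
  ultimately show ?thesis by blast
qed

theorem proposition5p21:
  fixes P :: "real \<Rightarrow> real" and J :: real and \<rho> :: "real^3 \<Rightarrow> real"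
  assumes "F1 P" and "F2 P" and "F3 P" and "F5 P"
    and "J \<ge> 0"
    and "\<rho> \<in> R0_class"
    and "E_energy P J \<rho> = \<infinity>"
  shows "(\<forall>\<sigma> \<in> admissible \<rho>. \<exists>\<delta>>0. \<forall>t. 0 < t \<and> t < \<delta> \<longrightarrow>
            (\<lambda>x. \<rho> x + t * \<sigma> x) \<in> energy_domain \<and> E_energy P J (\<lambda>x. \<rho> x + t * \<sigma> x) = \<infinity>)
         \<and> weak_local_minimizer P J \<rho>"
proof -
  have R: "\<rho> \<in> R_class" using assms(6) by (simp add: R0_class_def)
  then have \<rho>: "integrable lebesgue \<rho>" "AE x in lebesgue. 0 \<le> \<rho> x" "0 < mass \<rho>"
    by (auto simp: R_class_def)
  note main = E_energy_top_along_admissible[OF assms(1,2,4) \<rho> assms(7)]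
  have "\<exists>t :: nat \<Rightarrow> real. (\<forall>n. 0 < t n) \<and> t \<longlonglongrightarrow> 0 \<and>
      (\<forall>\<^sub>F n in sequentially. E_energy P J (\<lambda>x. \<rho> x + t n * \<sigma> x) \<ge> E_energy P J \<rho>)"
    if \<sigma>: "\<sigma> \<in> admissible \<rho>" for \<sigma>
  proof -
    obtain \<delta> where \<delta>: "0 < \<delta>"
      "\<And>t. 0 < t \<Longrightarrow> t < \<delta> \<Longrightarrow> E_energy P J (\<lambda>x. \<rho> x + t * \<sigma> x) = \<infinity>"
      using main[OF \<sigma>] by blast
    \<comment> \<open>Any positive null sequence serves: once it is below \<delta>, both energies
      are \<infinity> and the inequality is an equality.\<close>
    define t :: "nat \<Rightarrow> real" where "t n = inverse (real (Suc n))" for n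
    have t: "0 < t n" for n by (simp add: t_def)
    have lim: "t \<longlonglongrightarrow> 0" unfolding t_def by (rule LIMSEQ_inverse_real_of_nat)
    have "\<forall>\<^sub>F n in sequentially. t n < \<delta>"
      by (rule order_tendstoD(2)[OF lim \<delta>(1)])
    then have "\<forall>\<^sub>F n in sequentially. E_energy P J (\<lambda>x. \<rho> x + t n * \<sigma> x) \<ge> E_energy P J \<rho>"
      by eventually_elim (simp add: \<delta>(2) t)
    with t lim show ?thesis by blast
  qed
  then show ?thesis
    using main R unfolding weak_local_minimizer_def by blast
qed

end
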